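(* Let $d\ge 2$, let $P$ be a set of $n$ points in general position in $\mathbb{R}^d$, and let $0<r\le n$ be an integer. Then the simplicial partition $\Pi_d(P,r)=\{(P_i,\Delta_i)\}_{i=1}^r$ yields only $O(r^{d+1-1/d})$ crossed families $\{\Delta_{i_1},\dots,\Delta_{i_{d+1}}\}\subseteq \Sigma_d(P,r)$ with $1\le i_1<i_2<\cdots<i_{d+1}\le r$; the implicit constant depends only on $d$.
   Context: A point set in $\mathbb{R}^d$ is in general position if no $d+1$ of its points lie on a common hyperplane. A simplicial $r$-partition of an $n$-point set $P$ is a collection $\{(P_i,\Delta_i)\}_{i=1}^r$ where $P=\bigsqcup_{i=1}^r P_i$, each nonempty $P_i$ satisfies $\lceil n/r\rceil\le|P_i|<2\lceil n/r\rceil$, and each $\Delta_i$ is a closed $d$-dimensional simplex containing $P_i$ in its interior. $\Pi_d(P,r)$ denotes a fixed simplicial $r$-partition of $P$ such that every hyperplane intersects at most $c(d)r^{1-1/d}$ of the simplices $\Delta_i$, where $c(d)$ depends only on $d$ (such partitions exist by Matoušek's simplicial partition theorem), with the vertices of the simplices in general position; $\Sigma_d(P,r)=\{\Delta_1,\dots,\Delta_r\}$. A family of $d+1$ convex sets in $\mathbb{R}^d$ is crossed if it is not separated, where a family is separated if for every $2\le k\le d+1$ no $k$ of its members can all be intersected by a single $(k-2)$-dimensional affine flat. *)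

theory Defs
  imports "HOL-Analysis.Analysis"
begin

text \<open>The ambient space is \<open>real ^ 'd\<close>, so the dimension is \<open>CARD('d)\<close>.\<close>

definition hyperplane :: "(real ^ 'd) set \<Rightarrow> bool" where
  "hyperplane H \<longleftrightarrow> (\<exists>a b. a \<noteq> 0 \<and> H = {x. a \<bullet> x = b})"

definition flat :: "int \<Rightarrow> (real ^ 'd) set \<Rightarrow> bool" where
  "flat m F \<longleftrightarrow> affine F \<and> aff_dim F = m"

definition general_position :: "(real ^ 'd) set \<Rightarrow> bool" where
  "general_position P \<longleftrightarrow>
     (\<forall>S \<subseteq> P. card S = CARD('d) + 1 \<longrightarrow> \<not> (\<exists>H. hyperplane H \<and> S \<subseteq> H))"

text \<open>Parts and simplices are indexed by \<open>{1..r}\<close>. Parts may be empty, and distinct indices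
  may in principle carry equal simplices; everything below counts indices.\<close>

definition simplicial_partition ::
    "(real ^ 'd) set \<Rightarrow> nat \<Rightarrow> (nat \<Rightarrow> (real ^ 'd) set) \<Rightarrow> (nat \<Rightarrow> (real ^ 'd) set) \<Rightarrow> bool" where
  "simplicial_partition P r Q \<Delta> \<longleftrightarrow>
     P = (\<Union>i\<in>{1..r}. Q i) \<and>
     disjoint_family_on Q {1..r} \<and>
     (\<forall>i\<in>{1..r}. Q i \<noteq> {} \<longrightarrow>
        \<lceil>real (card P) / real r\<rceil> \<le> int (card (Q i)) \<and>
        int (card (Q i)) < 2 * \<lceil>real (card P) / real r\<rceil>) \<and>
     (\<forall>i\<in>{1..r}. int CARD('d) simplex \<Delta> i \<and> Q i \<subseteq> interior (\<Delta> i))"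

definition low_crossing :: "real \<Rightarrow> nat \<Rightarrow> (nat \<Rightarrow> (real ^ 'd) set) \<Rightarrow> bool" where
  "low_crossing c r \<Delta> \<longleftrightarrow>
     (\<forall>H. hyperplane H \<longrightarrow>
        real (card {i \<in> {1..r}. H \<inter> \<Delta> i \<noteq> {}}) \<le> c * real r powr (1 - 1 / real CARD('d)))"

definition vertices :: "(real ^ 'd) set \<Rightarrow> (real ^ 'd) set" where
  "vertices S = {v. v extreme_point_of S}"

text \<open>The properties of the partition \<open>\<Pi>\<^sub>d(P,r)\<close>, where \<open>c\<close> is the constant \<open>c(d)\<close> of the
  simplicial partition theorem.\<close>

definition matousek_partition ::
    "real \<Rightarrow> (real ^ 'd) set \<Rightarrow> nat \<Rightarrow> (nat \<Rightarrow> (real ^ 'd) set) \<Rightarrow> (nat \<Rightarrow> (real ^ 'd) set) \<Rightarrow> bool" where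
  "matousek_partition c P r Q \<Delta> \<longleftrightarrow>
     simplicial_partition P r Q \<Delta> \<and> low_crossing c r \<Delta> \<and>
     general_position (\<Union>i\<in>{1..r}. vertices (\<Delta> i))"

text \<open>Intended for families of \<open>CARD('d) + 1\<close> convex sets.\<close>

definition separated_family :: "(nat \<Rightarrow> (real ^ 'd) set) \<Rightarrow> nat set \<Rightarrow> bool" where
  "separated_family \<Delta> I \<longleftrightarrow>
     (\<forall>k. 2 \<le> k \<and> k \<le> CARD('d) + 1 \<longrightarrow>
        (\<forall>J \<subseteq> I. card J = k \<longrightarrow>
           \<not> (\<exists>F. flat (int k - 2) F \<and> (\<forall>j\<in>J. F \<inter> \<Delta> j \<noteq> {}))))"

definition crossed_family :: "(nat \<Rightarrow> (real ^ 'd) set) \<Rightarrow> nat set \<Rightarrow> bool" where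
  "crossed_family \<Delta> I \<longleftrightarrow> \<not> separated_family \<Delta> I"

end

theory Submission
  imports Defs
begin

text \<open>
  A flat of dimension \<open>k - 2\<close> meeting \<open>k\<close> members of a family of \<open>d + 1\<close> sets extends, by adjoining
  one point of each remaining member, to a hyperplane meeting all of them. So a crossed family is
  met by one hyperplane, which can be moved, without pushing any vertex of a simplex strictly
  across it, until it is spanned by \<open>d\<close> of the vertices. These vertices belong to at most
  \<open>d\<close> of the simplices, hence the family consists of \<open>d\<close> simplices together with one
  further simplex met by one of the boundedly many hyperplanes spanned by their vertices. There are
  at most \<open>r\<^sup>d\<close> choices for the former and \<open>c r\<^bsup>1 - 1/d\<^esup>\<close> choices for the latter.
\<close>

section \<open>Hyperplanes relative to finite point sets\<close>

lemma aff_dim_Un_le_card: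
  fixes F :: "'a::euclidean_space set"
  assumes "finite S"
  shows "aff_dim (F \<union> S) \<le> aff_dim F + int (card S)"
  using assms
proof (induction S rule: finite_induct)
  case (insert x S)
  then show ?case by (simp add: aff_dim_insert)
qed simp

text \<open>Subtract from the equation \<open>a \<bullet> x = b\<close> a multiple of an equation
  that vanishes on every point of \<open>V\<close> already on the hyperplane. These points stay, and
  the multiple is chosen so that a further point is reached before any point is crossed. Induction
  is on the number of points off the hyperplane.\<close>

lemma rotate_hyperplane_onto_points:
  fixes V :: "'a::euclidean_space set"
  assumes "finite V" and "aff_dim V = DIM('a)" and "a \<noteq> 0"
  shows "\<exists>a' b'. a' \<noteq> 0 \<and>
           (\<forall>v\<in>V. (a \<bullet> v \<le> b \<longrightarrow> a' \<bullet> v \<le> b') \<and> (b \<le> a \<bullet> v \<longrightarrow> b' \<le> a' \<bullet> v)) \<and>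
           int DIM('a) - 1 \<le> aff_dim {v\<in>V. a' \<bullet> v = b'}"
  using \<open>a \<noteq> 0\<close>
proof (induction "card {v\<in>V. a \<bullet> v \<noteq> b}" arbitrary: a b rule: less_induct)
  case less
  define Z where "Z = {v\<in>V. a \<bullet> v = b}"
  have not_in_hyperplane: "\<not> V \<subseteq> {x. p \<bullet> x = q}" if "p \<noteq> 0" for p q
    using aff_dim_subset[of V "{x. p \<bullet> x = q}"] aff_dim_hyperplane[OF that, of q] assms(2) by auto
  show ?case
  proof (cases "int DIM('a) - 1 \<le> aff_dim Z")
    case True
    then show ?thesis using less.prems unfolding Z_def by blast
  next
    case False
    obtain v0 where v0: "v0 \<in> V" "a \<bullet> v0 \<noteq> b"
      using not_in_hyperplane[OF less.prems, of b] by blast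
    \<comment> \<open>The auxiliary hyperplane passes through \<open>Z\<close>, which keeps these
      points in place, and also through \<open>v0\<close>, whose nonzero value is thus unchanged;
      this will exclude \<open>a' = 0\<close>.\<close>
    have "aff_dim (insert v0 Z) < DIM('a)"
      using False by (simp add: aff_dim_insert)
    then obtain p q where p: "p \<noteq> 0" and pq: "insert v0 Z \<subseteq> {x. p \<bullet> x = q}"
      using aff_lowdim_subset_hyperplane by metis
    \<comment> \<open>These are the points that a suitable multiple of the auxiliary equation can
      bring onto the hyperplane.\<close>
    define W where "W = {v\<in>V. a \<bullet> v \<noteq> b \<and> p \<bullet> v \<noteq> q}"
    have "W \<noteq> {}"
      using not_in_hyperplane[OF p, of q] pq unfolding W_def Z_def by blast
    have "finite W" using assms(1) unfolding W_def by simp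
    \<comment> \<open>\<open>ratio v\<close> is the size of the multiple at which \<open>v\<close>
      is hit. The minimizer \<open>v1\<close> is hit first, and \<open>t\<close> below restores the
      sign that this needs.\<close>
    define ratio where "ratio v = \<bar>(a \<bullet> v - b) / (p \<bullet> v - q)\<bar>" for v
    define v1 where "v1 = arg_min_on ratio W"
    have v1: "v1 \<in> W"
      unfolding v1_def using \<open>finite W\<close> \<open>W \<noteq> {}\<close> by (rule arg_min_if_finite)
    have min: "ratio v1 \<le> ratio v" if "v \<in> W" for v
      unfolding v1_def using \<open>finite W\<close> \<open>W \<noteq> {}\<close> that by (rule arg_min_least)
    define t where "t = (a \<bullet> v1 - b) / (p \<bullet> v1 - q)"
    define a' where "a' = a - t *\<^sub>R p"
    define b' where "b' = b - t * q"
    have diff: "a' \<bullet> v - b' = (a \<bullet> v - b) - t * (p \<bullet> v - q)" for v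
      unfolding a'_def b'_def by (simp add: algebra_simps)
    have v1_on: "a' \<bullet> v1 = b'"
      using diff[of v1] v1 unfolding t_def W_def by simp
    have "a' \<noteq> 0"
    proof
      assume "a' = 0"
      then have "b' = 0" using v1_on by simp
      then show False using diff[of v0] \<open>a' = 0\<close> v0 pq by simp
    qed
    \<comment> \<open>A change no larger than the old value cannot reverse its sign; minimality of
      \<open>ratio v1\<close> is exactly this bound.\<close>
    have small: "\<bar>t * (p \<bullet> v - q)\<bar> \<le> \<bar>a \<bullet> v - b\<bar>" if "v \<in> V" for v
    proof (cases "v \<in> W")
      case True
      then show ?thesis
        using min[OF True] unfolding ratio_def t_def[symmetric] by (simp add: W_def abs_mult abs_divide pos_le_divide_eq)
    next
      case False
      then have "p \<bullet> v = q" using that pq unfolding W_def Z_def by blast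
      then show ?thesis by simp
    qed
    have signs: "(a \<bullet> v \<le> b \<longrightarrow> a' \<bullet> v \<le> b') \<and> (b \<le> a \<bullet> v \<longrightarrow> b' \<le> a' \<bullet> v)" if "v \<in> V" for v
      using small[OF that] diff[of v] by linarith
    have "{v\<in>V. a' \<bullet> v \<noteq> b'} \<subset> {v\<in>V. a \<bullet> v \<noteq> b}"
    proof
      show "{v\<in>V. a' \<bullet> v \<noteq> b'} \<subseteq> {v\<in>V. a \<bullet> v \<noteq> b}" using signs by force
      show "{v\<in>V. a' \<bullet> v \<noteq> b'} \<noteq> {v\<in>V. a \<bullet> v \<noteq> b}" using v1 v1_on unfolding W_def by blast
    qed
    then have "card {v\<in>V. a' \<bullet> v \<noteq> b'} < card {v\<in>V. a \<bullet> v \<noteq> b}"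
      using assms(1) by (intro psubset_card_mono) auto
    from less.hyps[OF this \<open>a' \<noteq> 0\<close>] show ?thesis using signs by blast
  qed
qed

text \<open>Open half-spaces are convex, and a linear functional on a connected set takes all
  intermediate values. Meeting a simplex thus depends only on weak signs at its vertices, which the
  rotation preserves.\<close>

lemma hyperplane_meets_convex_hull_iff:
  fixes V :: "'a::euclidean_space set"
  shows "{x. a \<bullet> x = b} \<inter> convex hull V \<noteq> {} \<longleftrightarrow>
           (\<exists>u\<in>V. a \<bullet> u \<le> b) \<and> (\<exists>w\<in>V. b \<le> a \<bullet> w)"
proof
  assume meets: "{x. a \<bullet> x = b} \<inter> convex hull V \<noteq> {}"
  show "(\<exists>u\<in>V. a \<bullet> u \<le> b) \<and> (\<exists>w\<in>V. b \<le> a \<bullet> w)"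
  proof (rule ccontr)
    assume "\<not> ?thesis"
    then have "V \<subseteq> {x. a \<bullet> x > b} \<or> V \<subseteq> {x. a \<bullet> x < b}" by force
    then have "convex hull V \<subseteq> {x. a \<bullet> x > b} \<or> convex hull V \<subseteq> {x. a \<bullet> x < b}"
      using hull_minimal convex_halfspace_gt convex_halfspace_lt by metis
    then show False using meets by force
  qed
next
  assume "(\<exists>u\<in>V. a \<bullet> u \<le> b) \<and> (\<exists>w\<in>V. b \<le> a \<bullet> w)"
  then obtain u w where "u \<in> convex hull V" "w \<in> convex hull V" "a \<bullet> u \<le> b" "b \<le> a \<bullet> w"
    using hull_inc by metis
  then show "{x. a \<bullet> x = b} \<inter> convex hull V \<noteq> {}"
    using connected_ivt_hyperplane[of "convex hull V" u w a b] convex_connected[OF convex_convex_hull]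
    by blast
qed

section \<open>From crossed families to hyperplanes spanned by vertices\<close>

lemma full_simplex_vertices:
  fixes S :: "(real ^ 'd) set"
  assumes "int CARD('d) simplex S"
  shows "finite (vertices S)" and "card (vertices S) = CARD('d) + 1"
    and "S = convex hull vertices S" and "aff_dim (vertices S) = CARD('d)"
proof -
  obtain K where K: "\<not> affine_dependent K" "int (card K) = int CARD('d) + 1" "S = convex hull K"
    using assms unfolding simplex_def by auto
  have "vertices S = K"
    unfolding vertices_def K(3) using extreme_point_of_convex_hull_affine_independent[OF K(1)] by auto
  with K show "finite (vertices S)" "card (vertices S) = CARD('d) + 1" "S = convex hull vertices S"
      "aff_dim (vertices S) = CARD('d)"
    using aff_independent_finite[OF K(1)] aff_dim_affine_independent[OF K(1)] by auto
qed

lemma crossed_family_imp_hyperplane: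
  fixes \<Delta> :: "nat \<Rightarrow> (real ^ 'd) set"
  assumes "finite I" and "card I = CARD('d) + 1" and "\<And>i. i \<in> I \<Longrightarrow> \<Delta> i \<noteq> {}"
    and "crossed_family \<Delta> I"
  obtains a b where "a \<noteq> 0" and "\<And>i. i \<in> I \<Longrightarrow> {x. a \<bullet> x = b} \<inter> \<Delta> i \<noteq> {}"
proof -
  obtain k J F where J: "J \<subseteq> I" "card J = k" and F: "aff_dim F = int k - 2"
    and meets: "\<And>j. j \<in> J \<Longrightarrow> F \<inter> \<Delta> j \<noteq> {}"
    using assms(4) unfolding crossed_family_def separated_family_def flat_def by blast
  have "\<forall>i\<in>I. \<exists>x. x \<in> \<Delta> i" using assms(3) by blast
  then obtain pt where pt: "\<And>i. i \<in> I \<Longrightarrow> pt i \<in> \<Delta> i" by metis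
  have "card (pt ` (I - J)) \<le> card (I - J)" using assms(1) by (intro card_image_le) simp
  also have "\<dots> = CARD('d) + 1 - k" using J assms(1,2) by (simp add: card_Diff_subset finite_subset)
  finally have "int (card (pt ` (I - J))) \<le> int CARD('d) + 1 - int k"
    using J assms(1,2) card_mono[of I J] by linarith
  \<comment> \<open>\<open>F\<close> has dimension \<open>k - 2\<close>, and each of the at most
    \<open>d + 1 - k\<close> added points raises it by at most one, giving at most
    \<open>d - 1\<close>.\<close>
  then have "aff_dim (F \<union> pt ` (I - J)) < DIM(real ^ 'd)"
    using aff_dim_Un_le_card[of "pt ` (I - J)" F] F assms(1) by simp
  then obtain a b where ab: "a \<noteq> 0" "F \<union> pt ` (I - J) \<subseteq> {x. a \<bullet> x = b}"
    using aff_lowdim_subset_hyperplane by metis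
  have "{x. a \<bullet> x = b} \<inter> \<Delta> i \<noteq> {}" if "i \<in> I" for i
    using meets[of i] pt[OF that] ab(2) that by (cases "i \<in> J") blast+
  with ab(1) show thesis by (rule that)
qed

text \<open>Rotate a hyperplane meeting the family onto its vertices and take an affine basis
  \<open>B\<close> of the vertices reached. Describing the hyperplane by \<open>B\<close> makes the
  candidates countable, and the size of \<open>B\<close> bounds how many simplices supply
  it.\<close>

lemma crossed_family_imp_vertex_hyperplane:
  fixes \<Delta> :: "nat \<Rightarrow> (real ^ 'd) set"
  assumes "finite I" and "card I = CARD('d) + 1"
    and simplices: "\<And>i. i \<in> I \<Longrightarrow> int CARD('d) simplex \<Delta> i"
    and "crossed_family \<Delta> I"
  obtains B where "B \<subseteq> (\<Union>i\<in>I. vertices (\<Delta> i))" and "card B = CARD('d)"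
    and "hyperplane (affine hull B)" and "\<And>i. i \<in> I \<Longrightarrow> affine hull B \<inter> \<Delta> i \<noteq> {}"
proof -
  define V where "V = (\<Union>i\<in>I. vertices (\<Delta> i))"
  note vert = full_simplex_vertices[OF simplices]
  have nonempty: "\<Delta> i \<noteq> {}" if "i \<in> I" for i
  proof -
    have "vertices (\<Delta> i) \<noteq> {}" using vert(2)[OF that] by auto
    then have "convex hull vertices (\<Delta> i) \<noteq> {}" by simp
    then show ?thesis using vert(3)[OF that] by simp
  qed
  obtain a b where a: "a \<noteq> 0" and ab: "\<And>i. i \<in> I \<Longrightarrow> {x. a \<bullet> x = b} \<inter> \<Delta> i \<noteq> {}"
    using crossed_family_imp_hyperplane[OF assms(1,2) nonempty assms(4)] by auto
  have "finite V" unfolding V_def using assms(1) vert(1) by simp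
  moreover have "aff_dim V = DIM(real ^ 'd)"
  proof -
    have "I \<noteq> {}" using assms(2) by auto
    then obtain i where "i \<in> I" by blast
    then have "aff_dim (vertices (\<Delta> i)) \<le> aff_dim V"
      unfolding V_def by (intro aff_dim_subset) blast
    then show ?thesis using vert(4)[OF \<open>i \<in> I\<close>] aff_dim_le_DIM[of V] by simp
  qed
  ultimately have "\<exists>a' b'. a' \<noteq> 0 \<and>
      (\<forall>v\<in>V. (a \<bullet> v \<le> b \<longrightarrow> a' \<bullet> v \<le> b') \<and> (b \<le> a \<bullet> v \<longrightarrow> b' \<le> a' \<bullet> v)) \<and>
      int DIM(real ^ 'd) - 1 \<le> aff_dim {v\<in>V. a' \<bullet> v = b'}"
    using a by (rule rotate_hyperplane_onto_points)
  then obtain a' b' where a': "a' \<noteq> 0"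
    and signs: "\<And>v. v \<in> V \<Longrightarrow> (a \<bullet> v \<le> b \<longrightarrow> a' \<bullet> v \<le> b') \<and> (b \<le> a \<bullet> v \<longrightarrow> b' \<le> a' \<bullet> v)"
    and dim: "int DIM(real ^ 'd) - 1 \<le> aff_dim {v\<in>V. a' \<bullet> v = b'}"
    by blast
  define H where "H = {x. a' \<bullet> x = b'}"
  have H_dim: "aff_dim H = int CARD('d) - 1"
    unfolding H_def using aff_dim_hyperplane[OF a', of b'] by simp
  have meets: "H \<inter> \<Delta> i \<noteq> {}" if "i \<in> I" for i
  proof -
    have sub: "vertices (\<Delta> i) \<subseteq> V" using that unfolding V_def by blast
    have "{x. a \<bullet> x = b} \<inter> convex hull vertices (\<Delta> i) \<noteq> {}"
      using ab[OF that] vert(3)[OF that] by simp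
    then have "H \<inter> convex hull vertices (\<Delta> i) \<noteq> {}"
      unfolding H_def hyperplane_meets_convex_hull_iff using signs sub by blast
    then show ?thesis using vert(3)[OF that] by simp
  qed
  obtain B where B: "\<not> affine_dependent B" "B \<subseteq> {v\<in>V. a' \<bullet> v = b'}"
      "affine hull B = affine hull {v\<in>V. a' \<bullet> v = b'}"
    using affine_basis_exists[of "{v\<in>V. a' \<bullet> v = b'}"] by auto
  have B_dim: "aff_dim B = aff_dim {v\<in>V. a' \<bullet> v = b'}" using B(3) by (rule aff_dim_affine_hull2)
  have "B \<subseteq> H" using B(2) unfolding H_def by blast
  \<comment> \<open>The rotation gives dimension at least \<open>d - 1\<close>, and lying in
    \<open>H\<close> gives at most that; so \<open>B\<close> spans \<open>H\<close> and, being
    independent, has \<open>d\<close> points.\<close>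
  then have "aff_dim B = aff_dim H" using B_dim dim H_dim aff_dim_subset[of B H] by simp
  then have "affine hull B = H"
    using aff_dim_eq_full_gen[of B H] \<open>B \<subseteq> H\<close> hull_same[of affine H] affine_hyperplane[of a' b']
    unfolding H_def by simp
  moreover have "card B = CARD('d)"
    using aff_dim_affine_independent[OF B(1)] \<open>aff_dim B = aff_dim H\<close> H_dim by linarith
  moreover have "hyperplane H" unfolding hyperplane_def H_def using a' by blast
  moreover have "B \<subseteq> (\<Union>i\<in>I. vertices (\<Delta> i))" using B(2) unfolding V_def by blast
  ultimately show thesis using that[of B] meets by simp
qed

section \<open>Counting crossed families\<close>

lemma card_UN_le_mult:
  assumes "finite A" and "\<And>x. x \<in> A \<Longrightarrow> real (card (f x)) \<le> m" and "0 \<le> m" and "real (card A) \<le> k"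
  shows "real (card (\<Union>x\<in>A. f x)) \<le> k * m"
proof -
  have "real (card (\<Union>x\<in>A. f x)) \<le> (\<Sum>x\<in>A. real (card (f x)))"
    using card_UN_le[OF assms(1), of f] by (simp flip: of_nat_sum)
  also have "\<dots> \<le> card A * m" using assms(2) by (intro sum_bounded_above) auto
  also have "\<dots> \<le> k * m" using assms(3,4) by (intro mult_right_mono)
  finally show ?thesis .
qed

text \<open>Each crossed family is recovered from a triple: \<open>d\<close> of its indices, a set
  of their vertices spanning a hyperplane, and an index whose simplex meets that hyperplane. The
  three factors bound the choices; \<open>d\<close> simplices have at most
  \<open>d * (d + 1)\<close> vertices in all.\<close>

lemma card_crossed_families_le:
  fixes \<Delta> :: "nat \<Rightarrow> (real ^ 'd) set"
  defines "d \<equiv> CARD('d)"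
  assumes simplices: "\<And>i. i \<in> {1..r} \<Longrightarrow> int d simplex \<Delta> i"
    and low: "\<And>H. hyperplane H \<Longrightarrow> real (card {i\<in>{1..r}. H \<inter> \<Delta> i \<noteq> {}}) \<le> m"
    and "0 \<le> m"
  shows "real (card {I. I \<subseteq> {1..r} \<and> card I = d + 1 \<and> crossed_family \<Delta> I})
           \<le> real r ^ d * (2 ^ (d * (d + 1)) * m)"
proof -
  define \<T> where "\<T> = {T. T \<subseteq> {1..r} \<and> card T = d}"
  define \<B> where "\<B> T = {B. B \<subseteq> (\<Union>j\<in>T. vertices (\<Delta> j)) \<and> hyperplane (affine hull B)}" for T
  define \<X> where "\<X> T B = (\<lambda>i. insert i T) ` {i\<in>{1..r}. affine hull B \<inter> \<Delta> i \<noteq> {}}" for T B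
  note vert = full_simplex_vertices[OF simplices[unfolded d_def]]
  have cover: "{I. I \<subseteq> {1..r} \<and> card I = d + 1 \<and> crossed_family \<Delta> I} \<subseteq> (\<Union>T\<in>\<T>. \<Union>B\<in>\<B> T. \<X> T B)"
  proof
    fix I assume "I \<in> {I. I \<subseteq> {1..r} \<and> card I = d + 1 \<and> crossed_family \<Delta> I}"
    then have I: "I \<subseteq> {1..r}" "card I = d + 1" "crossed_family \<Delta> I" by auto
    have "finite I" using I(1) finite_subset by blast
    obtain B where B: "B \<subseteq> (\<Union>i\<in>I. vertices (\<Delta> i))" "card B = d" "hyperplane (affine hull B)"
        "\<And>i. i \<in> I \<Longrightarrow> affine hull B \<inter> \<Delta> i \<noteq> {}"
    proof (rule crossed_family_imp_vertex_hyperplane[of I \<Delta>])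
      show "int CARD('d) simplex \<Delta> i" if "i \<in> I" for i
        using that I(1) simplices unfolding d_def by blast
    qed (use I \<open>finite I\<close> in \<open>auto simp: d_def\<close>)
    have "\<forall>v\<in>B. \<exists>i. i \<in> I \<and> v \<in> vertices (\<Delta> i)" using B(1) by blast
    then obtain g where g: "\<And>v. v \<in> B \<Longrightarrow> g v \<in> I \<and> v \<in> vertices (\<Delta> (g v))" by metis
    \<comment> \<open>Several vertices may come from one simplex, so the set of owners can have
      fewer than \<open>d\<close> elements and is enlarged inside \<open>I\<close> to exactly
      \<open>d\<close>. Finiteness of \<open>B\<close> follows from its positive
      cardinality.\<close>
    have "card (g ` B) \<le> d"
      using B(2) card_image_le[of B g] card_ge_0_finite[of B] unfolding d_def by simp
    moreover have "g ` B \<subseteq> I" using g by blast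
    ultimately obtain T where T: "g ` B \<subseteq> T" "T \<subseteq> I" "card T = d"
      using exists_subset_between[of "g ` B" d I] I(2) \<open>finite I\<close> by auto
    have "card (I - T) = 1"
      using T I(2) \<open>finite I\<close> by (simp add: card_Diff_subset finite_subset)
    then obtain i where "I - T = {i}" by (rule card_1_singletonE)
    then have "I = insert i T" "i \<in> I" using T(2) by auto
    then have "I \<in> \<X> T B" using B(4) I(1) unfolding \<X>_def by blast
    moreover have "B \<in> \<B> T" using B(3) T(1) g unfolding \<B>_def by blast
    moreover have "T \<in> \<T>" using T I(1) unfolding \<T>_def by blast
    ultimately show "I \<in> (\<Union>T\<in>\<T>. \<Union>B\<in>\<B> T. \<X> T B)" by blast
  qed
  have "finite \<T>" unfolding \<T>_def by (rule finite_subset[of _ "Pow {1..r}"]) auto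
  have "card \<T> = r choose d" unfolding \<T>_def using n_subsets[of "{1..r}" d] by simp
  \<comment> \<open>For \<open>r < d\<close> the binomial coefficient is zero.\<close>
  also have "\<dots> \<le> r ^ d" by (cases "d \<le> r") (simp_all add: binomial_le_pow binomial_eq_0)
  finally have card_\<T>: "real (card \<T>) \<le> real r ^ d" by (metis of_nat_le_iff of_nat_power)
  have \<B>_bound: "finite (\<B> T)" "real (card (\<B> T)) \<le> 2 ^ (d * (d + 1))" if "T \<in> \<T>" for T
  proof -
    define U where "U = (\<Union>j\<in>T. vertices (\<Delta> j))"
    have T: "T \<subseteq> {1..r}" "card T = d" "finite T"
      using that finite_subset[of T "{1..r}"] unfolding \<T>_def by auto
    have "finite U" unfolding U_def using T vert(1) by blast
    have "card U \<le> (\<Sum>j\<in>T. card (vertices (\<Delta> j)))" unfolding U_def by (rule card_UN_le[OF T(3)])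
    also have "\<dots> = (\<Sum>j\<in>T. d + 1)"
      using T(1) vert(2) unfolding d_def by (intro sum.cong) auto
    finally have U_le: "card U \<le> d * (d + 1)" using T(2) by simp
    have sub: "\<B> T \<subseteq> Pow U" unfolding \<B>_def U_def by blast
    then show "finite (\<B> T)" using \<open>finite U\<close> by (simp add: finite_subset)
    have "card (\<B> T) \<le> 2 ^ card U"
      using card_mono[OF _ sub] \<open>finite U\<close> by (simp add: card_Pow)
    also have "\<dots> \<le> 2 ^ (d * (d + 1))" using U_le by (intro power_increasing) auto
    finally show "real (card (\<B> T)) \<le> 2 ^ (d * (d + 1))"
      by (metis of_nat_le_iff of_nat_numeral of_nat_power)
  qed
  have \<X>_bound: "real (card (\<X> T B)) \<le> m" if "B \<in> \<B> T" for T B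
  proof -
    have "card (\<X> T B) \<le> card {i\<in>{1..r}. affine hull B \<inter> \<Delta> i \<noteq> {}}"
      unfolding \<X>_def by (intro card_image_le) simp
    then show ?thesis using low[of "affine hull B"] that unfolding \<B>_def by fastforce
  qed
  have inner: "real (card (\<Union>B\<in>\<B> T. \<X> T B)) \<le> 2 ^ (d * (d + 1)) * m" if "T \<in> \<T>" for T
    using \<B>_bound[OF that] \<X>_bound \<open>0 \<le> m\<close> by (intro card_UN_le_mult)
  have "finite (\<Union>T\<in>\<T>. \<Union>B\<in>\<B> T. \<X> T B)"
    using \<open>finite \<T>\<close> \<B>_bound(1) unfolding \<X>_def by (intro finite_UN_I) auto
  then have "real (card {I. I \<subseteq> {1..r} \<and> card I = d + 1 \<and> crossed_family \<Delta> I})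
      \<le> real (card (\<Union>T\<in>\<T>. \<Union>B\<in>\<B> T. \<X> T B))"
    using card_mono[OF _ cover] by simp
  also have "\<dots> \<le> real r ^ d * (2 ^ (d * (d + 1)) * m)"
    using \<open>0 \<le> m\<close> by (intro card_UN_le_mult[OF \<open>finite \<T>\<close> inner _ card_\<T>]) auto
  finally show ?thesis .
qed

theorem theorem3p1:
  fixes c :: real
  assumes "CARD('d::finite) \<ge> 2"
  shows "\<exists>C::real. \<forall>(P :: (real ^ 'd) set) (n::nat) (r::nat) Q \<Delta>.
           finite P \<and> card P = n \<and> general_position P \<and> 0 < r \<and> r \<le> n \<and>
           matousek_partition c P r Q \<Delta> \<longrightarrow>
             real (card {I. I \<subseteq> {1..r} \<and> card I = CARD('d) + 1 \<and> crossed_family \<Delta> I})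
               \<le> C * real r powr (real CARD('d) + 1 - 1 / real CARD('d))"
proof (intro exI allI impI)
  fix P :: "(real ^ 'd) set" and n r :: nat and Q \<Delta> :: "nat \<Rightarrow> (real ^ 'd) set"
  let ?d = "CARD('d)"
  \<comment> \<open>The absolute value makes \<open>m\<close> nonnegative for every
    \<open>c\<close>, as the multiplied bounds require.\<close>
  define m where "m = \<bar>c\<bar> * real r powr (1 - 1 / real ?d)"
  assume asm: "finite P \<and> card P = n \<and> general_position P \<and> 0 < r \<and> r \<le> n \<and>
    matousek_partition c P r Q \<Delta>"
  then have simplices: "int ?d simplex \<Delta> i" if "i \<in> {1..r}" for i
    using that unfolding matousek_partition_def simplicial_partition_def by blast
  have low: "real (card {i\<in>{1..r}. H \<inter> \<Delta> i \<noteq> {}}) \<le> m" if "hyperplane H" for H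
  proof -
    have "real (card {i\<in>{1..r}. H \<inter> \<Delta> i \<noteq> {}}) \<le> c * real r powr (1 - 1 / real ?d)"
      using asm that unfolding matousek_partition_def low_crossing_def by blast
    also have "\<dots> \<le> m" unfolding m_def by (intro mult_right_mono) auto
    finally show ?thesis .
  qed
  have "0 \<le> m" unfolding m_def by simp
  \<comment> \<open>Positivity of \<open>r\<close> allows the natural power to be rewritten with
    \<open>powr\<close>, so that the exponents add.\<close>
  have "real r ^ ?d * real r powr (1 - 1 / real ?d) = real r powr (real ?d + 1 - 1 / real ?d)"
    using asm by (simp add: powr_realpow[symmetric] powr_add[symmetric] algebra_simps)
  then have eq: "real r ^ ?d * (2 ^ (?d * (?d + 1)) * m)
      = (2 ^ (?d * (?d + 1)) * \<bar>c\<bar>) * real r powr (real ?d + 1 - 1 / real ?d)"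
    unfolding m_def by (simp add: mult.assoc mult.left_commute)
  \<comment> \<open>The witness for \<open>C\<close> is fixed here; it involves only
    \<open>d\<close> and \<open>c\<close>.\<close>
  show "real (card {I. I \<subseteq> {1..r} \<and> card I = ?d + 1 \<and> crossed_family \<Delta> I})
      \<le> (2 ^ (?d * (?d + 1)) * \<bar>c\<bar>) * real r powr (real ?d + 1 - 1 / real ?d)"
    using card_crossed_families_le[OF simplices low \<open>0 \<le> m\<close>] unfolding eq .
qed

end
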